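(* No planar continuum is $4$-sac.
   Context: A continuum is a compact connected metric space; it is planar if it is (homeomorphic to) a subspace of $\mathbb{R}^2$. An arc in a space $X$ is a homeomorphic embedding $\alpha:[0,1]\to X$ (or its image). A topological space $X$ is $n$-strongly arc connected ($n$-sac) if for every $n$ distinct points $x_1,\dots,x_n$ of $X$ there are an arc $\alpha:[0,1]\to X$ and $t_1<t_2<\dots<t_n$ in $[0,1]$ such that $\alpha(t_i)=x_i$ for $i=1,\dots,n$.
   Formalization: The continuum is assumed to have at least two points, because the empty space and the one-point space have no four distinct points and so are vacuously 4-sac. *)

theory Defs
  imports "HOL-Analysis.Analysis"
begin

(* Metrizability stands for "metric space": all notions below are topological.
   The empty space and one-point spaces are not excluded here. *)
definition continuum :: "'a topology \<Rightarrow> bool" where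
  "continuum X \<longleftrightarrow> metrizable_space X \<and> compact_space X \<and> connected_space X"

definition planar_space :: "'a topology \<Rightarrow> bool" where
  "planar_space X \<longleftrightarrow> (\<exists>S :: (real ^ 2) set. X homeomorphic_space top_of_set S)"

(* Only the values on {0..1} matter. *)
definition arc_in :: "'a topology \<Rightarrow> (real \<Rightarrow> 'a) \<Rightarrow> bool" where
  "arc_in X \<alpha> \<longleftrightarrow> embedding_map (top_of_set {0..1}) X \<alpha>"

(* The points are visited in the given order x 1, ..., x n. *)
definition n_sac :: "nat \<Rightarrow> 'a topology \<Rightarrow> bool" where
  "n_sac n X \<longleftrightarrow>
     (\<forall>x :: nat \<Rightarrow> 'a. x ` {1..n} \<subseteq> topspace X \<and> inj_on x {1..n} \<longrightarrow>
        (\<exists>\<alpha> t. arc_in X \<alpha> \<and> t ` {1..n} \<subseteq> {0..1} \<and> strict_mono_on {1..n} t \<and>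
               (\<forall>i\<in>{1..n}. \<alpha> (t i) = x i)))"

end

theory Submission
  imports Defs
begin

text \<open>
  A planar continuum may be taken to be a compact connected set \<open>S\<close> in the plane, with more than
  one point. Suppose that any four distinct points of \<open>S\<close> are visited, in the given order, by an
  arc in \<open>S\<close>.

  Every real-valued continuous function \<open>f\<close> on \<open>S\<close> then takes each value \<open>c\<close> strictly between two of
  its values at least twice: if \<open>p\<close> were the only point of level \<open>c\<close>, an arc visiting a point below
  level \<open>c\<close>, then a point above it, and then \<open>p\<close>, would pass through \<open>p\<close> twice
  (\<open>sac_level_not_singleton\<close>). With the coordinates for \<open>f\<close>, it follows that \<open>S\<close> does not lie on
  a vertical line, and that a vertical line between the leftmost point \<open>l\<close> and the rightmost point
  \<open>r\<close> of \<open>S\<close> meets \<open>S\<close> in a lowest point \<open>s\<close> and a different highest point \<open>t\<close>. Now take an arc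
  that visits \<open>l\<close>, \<open>r\<close>, \<open>s\<close>, \<open>t\<close> in this order. Its piece from \<open>l\<close> to \<open>r\<close> crosses a rectangle
  around \<open>S\<close> from left to right. Its piece from \<open>s\<close> to \<open>t\<close>, prolonged vertically downwards from \<open>s\<close>
  and upwards from \<open>t\<close>, crosses the rectangle from bottom to top, and the prolongations miss
  \<open>S\<close> apart from \<open>s\<close> and \<open>t\<close>. By Fashoda's theorem the two crossings meet, so the two
  disjoint pieces of the arc meet, a contradiction (\<open>disjoint_crossing_pieces_impossible\<close>).
\<close>

lemma n_sacE:
  assumes "n_sac n X" "x ` {1..n} \<subseteq> topspace X" "inj_on x {1..n}"
  obtains \<alpha> t where "arc_in X \<alpha>" "t ` {1..n} \<subseteq> {0..1}" "strict_mono_on {1..n} t"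
    "\<forall>i\<in>{1..n}. \<alpha> (t i) = x i"
proof -
  have "\<exists>\<alpha> t. arc_in X \<alpha> \<and> t ` {1..n} \<subseteq> {0..1} \<and> strict_mono_on {1..n} t \<and>
               (\<forall>i\<in>{1..n}. \<alpha> (t i) = x i)"
    using assms(1)[unfolded n_sac_def, THEN spec[where x = x]] assms(2,3) by simp
  then show thesis
    using that by (elim exE conjE)
qed

lemma n_sac_homeomorphic_space:
  assumes "X homeomorphic_space Y" "n_sac n X"
  shows "n_sac n Y"
proof -
  obtain h k where hk: "homeomorphic_maps X Y h k"
    using assms(1) by (auto simp: homeomorphic_space_def)
  then have hmap: "homeomorphic_map X Y h"
    by (auto simp: homeomorphic_map_maps)
  then have emb: "embedding_map X Y h"
    using surjective_embedding_map by blast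
  have kX: "k y \<in> topspace X" and hk_id: "h (k y) = y" if "y \<in> topspace Y" for y
    using hk that by (auto simp: homeomorphic_maps_def continuous_map_def)
  show ?thesis
    unfolding n_sac_def
  proof (intro allI impI)
    fix y :: "nat \<Rightarrow> 'b"
    assume y: "y ` {1..n} \<subseteq> topspace Y \<and> inj_on y {1..n}"
    have "(k \<circ> y) ` {1..n} \<subseteq> topspace X"
      using y kX by auto
    moreover have "inj_on (k \<circ> y) {1..n}"
    proof (rule comp_inj_on)
      show "inj_on y {1..n}"
        using y by blast
      show "inj_on k (y ` {1..n})"
        by (rule inj_on_inverseI[where g = h]) (use y hk_id in blast)
    qed
    ultimately obtain \<alpha> t where \<alpha>: "arc_in X \<alpha>"
      and t: "t ` {1..n} \<subseteq> {0..1}" "strict_mono_on {1..n} t"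
      and visits: "\<forall>i\<in>{1..n}. \<alpha> (t i) = (k \<circ> y) i"
      by (rule n_sacE[OF assms(2)])
    have "arc_in Y (h \<circ> \<alpha>)"
      using \<alpha> emb unfolding arc_in_def by (blast intro: embedding_map_compose)
    moreover have "\<forall>i\<in>{1..n}. (h \<circ> \<alpha>) (t i) = y i"
      using visits y hk_id by auto
    ultimately show "\<exists>\<alpha> t. arc_in Y \<alpha> \<and> t ` {1..n} \<subseteq> {0..1} \<and> strict_mono_on {1..n} t \<and>
               (\<forall>i\<in>{1..n}. \<alpha> (t i) = y i)"
      using t by blast
  qed
qed

lemma arc_in_top_of_setD:
  assumes "arc_in (top_of_set S) \<gamma>"
  shows "path \<gamma>" "inj_on \<gamma> {0..1}" "\<gamma> ` {0..1} \<subseteq> S"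
proof -
  have hom: "homeomorphic_map (top_of_set {0..1}) (subtopology (top_of_set S) (\<gamma> ` {0..1})) \<gamma>"
    using assms by (simp add: arc_in_def embedding_map_def)
  then have "continuous_map (top_of_set {0..1}) (top_of_set S) \<gamma>"
    using homeomorphic_imp_continuous_map continuous_map_into_fulltopology by blast
  then show "path \<gamma>" "\<gamma> ` {0..1} \<subseteq> S"
    by (auto simp: path_def)
  show "inj_on \<gamma> {0..1}"
    using homeomorphic_imp_injective_map[OF hom] by simp
qed

lemma four_sacE:
  assumes "n_sac 4 (top_of_set S)" "distinct [a, b, c, d]" "{a, b, c, d} \<subseteq> S"
  obtains \<gamma> t1 t2 t3 t4 where
    "path \<gamma>" "inj_on \<gamma> {0..1}" "\<gamma> ` {0..1} \<subseteq> S"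
    "0 \<le> t1" "t1 < t2" "t2 < t3" "t3 < t4" "t4 \<le> 1"
    "\<gamma> t1 = a" "\<gamma> t2 = b" "\<gamma> t3 = c" "\<gamma> t4 = d"
proof -
  define x where "x i = [a, b, c, d] ! (i - 1)" for i :: nat
  have I: "{1..4::nat} = {1, 2, 3, 4}"
    by auto
  have x: "x 1 = a" "x 2 = b" "x 3 = c" "x 4 = d"
    by (simp_all add: x_def numeral_eq_Suc)
  have "x ` {1..4} \<subseteq> topspace (top_of_set S)" "inj_on x {1..4}"
    using assms(2,3) x by (auto simp: I inj_on_def simp del: One_nat_def)
  then obtain \<gamma> t where \<gamma>: "arc_in (top_of_set S) \<gamma>"
    and t: "t ` {1..4} \<subseteq> {0..1}" and mono: "strict_mono_on {1..4::nat} t"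
    and visits: "\<forall>i\<in>{1..4}. \<gamma> (t i) = x i"
    by (rule n_sacE[OF assms(1)])
  have "t 1 < t 2" "t 2 < t 3" "t 3 < t 4"
    by (auto intro!: strict_mono_onD[OF mono])
  moreover have "0 \<le> t 1" "t 4 \<le> 1"
    using t by (simp_all add: image_subset_iff)
  ultimately show thesis
    using that[of \<gamma> "t 1" "t 2" "t 3" "t 4"] arc_in_top_of_setD[OF \<gamma>] visits x by simp
qed

text \<open>
  If \<open>p\<close> were the only point of level \<open>c\<close>, then by the intermediate value theorem every path from
  below level \<open>c\<close> to above it would run through \<open>p\<close>, and an arc could not visit \<open>p\<close> afterwards.
\<close>

lemma sac_level_not_singleton:
  fixes f :: "'a::topological_space \<Rightarrow> real"
  assumes sac: "n_sac 4 (top_of_set S)" and conn: "connected S" and cont: "continuous_on S f"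
    and lr: "l \<in> S" "r \<in> S" "f l < c" "c < f r"
  obtains s t where "s \<in> S" "t \<in> S" "s \<noteq> t" "f s = c" "f t = c"
proof -
  have "connected (f ` S)"
    using conn cont by (rule connected_continuous_image[rotated])
  then have attained: "\<exists>p\<in>S. f p = v" if "f l \<le> v" "v \<le> f r" for v
    using connectedD_interval[of "f ` S" "f l" "f r" v] lr that by auto
  obtain p where p: "p \<in> S" "f p = c"
    using attained[of c] lr by auto
  \<comment> \<open>The intermediate value makes the fourth point differ from \<open>l\<close>, \<open>r\<close> and \<open>p\<close>.\<close>
  obtain q where q: "q \<in> S" "f q = (f l + c) / 2"
    using attained[of "(f l + c) / 2"] lr by auto
  have "distinct [l, r, p, q]" "{l, r, p, q} \<subseteq> S"
    using lr p q by auto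
  then obtain \<gamma> t1 t2 t3 t4 where \<gamma>: "path \<gamma>" "inj_on \<gamma> {0..1}" "\<gamma> ` {0..1} \<subseteq> S"
    and t: "0 \<le> t1" "t1 < t2" "t2 < t3" "t3 < t4" "t4 \<le> 1"
    and visits: "\<gamma> t1 = l" "\<gamma> t2 = r" "\<gamma> t3 = p" "\<gamma> t4 = q"
    by (rule four_sacE[OF sac])
  have sub: "{t1..t2} \<subseteq> {0..1}"
    using t by auto
  have "continuous_on {t1..t2} (\<lambda>u. f (\<gamma> u))"
  proof (rule continuous_on_compose2[OF cont])
    show "continuous_on {t1..t2} \<gamma>"
      using \<gamma>(1) sub continuous_on_subset unfolding path_def by blast
    show "\<gamma> ` {t1..t2} \<subseteq> S"
      using \<gamma>(3) sub by blast
  qed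
  then obtain u where u: "t1 \<le> u" "u \<le> t2" "f (\<gamma> u) = c"
    using IVT'[of "\<lambda>u. f (\<gamma> u)" t1 c t2] visits lr t by auto
  have "u \<in> {0..1}" "t3 \<in> {0..1}" "u \<noteq> t3"
    using u t by auto
  then have "\<gamma> u \<noteq> p" "\<gamma> u \<in> S"
    using \<gamma>(2,3) visits(3) by (auto simp: inj_on_def)
  then show thesis
    using that[of p "\<gamma> u"] p u by simp
qed

text \<open>
  The planar heart of the argument. The bounding rectangle has the abscissas of \<open>l\<close> and \<open>r\<close> as its
  vertical sides, so the piece of the arc from \<open>l\<close> to \<open>r\<close> is a crossing; the extremality of \<open>s\<close> and
  \<open>t\<close> on their vertical line is what lets the piece from \<open>s\<close> to \<open>t\<close> be prolonged to a
  crossing in the other direction without meeting the arc again.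
\<close>

lemma disjoint_crossing_pieces_impossible:
  fixes S :: "(real ^ 2) set"
  assumes S: "bounded S"
    and lr: "\<And>x. x \<in> S \<Longrightarrow> l $ 1 \<le> x $ 1 \<and> x $ 1 \<le> r $ 1"
    and st: "s $ 1 = t $ 1"
      "\<And>x. x \<in> S \<Longrightarrow> x $ 1 = s $ 1 \<Longrightarrow> s $ 2 \<le> x $ 2 \<and> x $ 2 \<le> t $ 2"
    and \<gamma>: "path \<gamma>" "inj_on \<gamma> {0..1}" "\<gamma> ` {0..1} \<subseteq> S"
    and t: "0 \<le> t1" "t1 < t2" "t2 < t3" "t3 < t4" "t4 \<le> 1"
    and visits: "\<gamma> t1 = l" "\<gamma> t2 = r" "\<gamma> t3 = s" "\<gamma> t4 = t"
  shows False
proof -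
  obtain B where B: "\<And>x. x \<in> S \<Longrightarrow> norm x \<le> B"
    using S bounded_iff by blast
  have x2: "- B \<le> x $ 2 \<and> x $ 2 \<le> B" if "x \<in> S" for x
    using B[OF that] component_le_norm_cart[of x 2] by linarith
  define a b :: "real ^ 2" where "a = vector [l $ 1, - B]" and "b = vector [r $ 1, B]"
  have mem_box: "x \<in> cbox a b \<longleftrightarrow> l $ 1 \<le> x $ 1 \<and> x $ 1 \<le> r $ 1 \<and> - B \<le> x $ 2 \<and> x $ 2 \<le> B" for x
    by (auto simp: a_def b_def mem_box_cart forall_2 vector_2)
  have S_box: "S \<subseteq> cbox a b"
    using lr x2 by (auto simp: mem_box)
  have inS: "\<gamma> u \<in> S" if "0 \<le> u" "u \<le> 1" for u
    using \<gamma>(3) that by auto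
  have sS: "s \<in> S" and tS: "t \<in> S"
    using inS[of t3] inS[of t4] t visits by auto
  define s' t' :: "real ^ 2" where "s' = vector [s $ 1, - B]" and "t' = vector [s $ 1, B]"
  have below: "x $ 1 = s $ 1 \<and> - B \<le> x $ 2 \<and> x $ 2 \<le> s $ 2" if "x \<in> closed_segment s' s" for x
    using that x2[OF sS] by (auto simp: segment_vertical s'_def)
  have above: "x $ 1 = s $ 1 \<and> t $ 2 \<le> x $ 2 \<and> x $ 2 \<le> B" if "x \<in> closed_segment t t'" for x
    using that x2[OF tS] by (auto simp: segment_vertical t'_def st)
  define across where "across = subpath t1 t2 \<gamma>"
  define upward where "upward = linepath s' s +++ subpath t3 t4 \<gamma> +++ linepath t t'"
  have ends: "pathstart (subpath t3 t4 \<gamma>) = s" "pathfinish (subpath t3 t4 \<gamma>) = t"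
    using visits by auto
  have across_im: "path_image across = \<gamma> ` {t1..t2}"
    using t by (simp add: across_def path_image_subpath)
  have upward_im:
    "path_image upward = closed_segment s' s \<union> \<gamma> ` {t3..t4} \<union> closed_segment t t'"
    using t ends by (simp add: upward_def path_image_join path_image_subpath Un_assoc)
  have vertical_box: "closed_segment s' s \<subseteq> cbox a b" "closed_segment t t' \<subseteq> cbox a b"
    using below above lr[OF sS] x2[OF sS] x2[OF tS] unfolding subset_iff mem_box
    by (metis order_trans)+
  have arc_box: "\<gamma> ` {t1..t2} \<subseteq> cbox a b" "\<gamma> ` {t3..t4} \<subseteq> cbox a b"
    using inS t S_box by (auto simp: image_subset_iff subset_iff)
  obtain z where z: "z \<in> path_image across" "z \<in> path_image upward"
  proof (rule fashoda[of across upward a b])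
    show "path across"
      using \<gamma>(1) t by (simp add: across_def path_subpath)
    show "path upward"
      using \<gamma>(1) t ends by (simp add: upward_def path_subpath)
    show "path_image across \<subseteq> cbox a b" "path_image upward \<subseteq> cbox a b"
      using across_im upward_im vertical_box arc_box by auto
    show "pathstart across $ 1 = a $ 1" "pathfinish across $ 1 = b $ 1"
      using visits by (simp_all add: across_def a_def b_def)
    show "pathstart upward $ 2 = a $ 2" "pathfinish upward $ 2 = b $ 2"
      by (simp_all add: upward_def a_def b_def s'_def t'_def)
  qed
  obtain u where u: "t1 \<le> u" "u \<le> t2" "z = \<gamma> u"
    using z(1) across_im by auto
  have zS: "z \<in> S"
    using inS u t by simp
  have same_column: "z = s" if "z \<in> closed_segment s' s"
    using below[OF that] st(2)[OF zS] by (auto simp: vec_eq_iff forall_2)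
  have same_column': "z = t" if "z \<in> closed_segment t t'"
    using above[OF that] st(2)[OF zS] st(1) by (auto simp: vec_eq_iff forall_2)
  have "z \<in> \<gamma> ` {t3..t4}"
    using z(2) upward_im same_column same_column' visits t by auto
  then obtain v where "t3 \<le> v" "v \<le> t4" "z = \<gamma> v"
    by auto
  then have "u = v"
    using u t by (intro inj_onD[OF \<gamma>(2)]) auto
  then show False
    using \<open>t3 \<le> v\<close> u t by simp
qed

lemma plane_continuum_not_4_sac:
  fixes S :: "(real ^ 2) set"
  assumes comp: "compact S" and conn: "connected S" and ne: "\<exists>x\<in>S. \<exists>y\<in>S. x \<noteq> y"
  shows "\<not> n_sac 4 (top_of_set S)"
proof
  assume sac: "n_sac 4 (top_of_set S)"
  have cont: "continuous_on A (\<lambda>x. x $ i)" for A :: "(real ^ 2) set" and i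
    by (intro continuous_intros)
  have "S \<noteq> {}"
    using ne by auto
  obtain l where l: "l \<in> S" "\<And>x. x \<in> S \<Longrightarrow> l $ 1 \<le> x $ 1"
    using continuous_attains_inf[OF comp \<open>S \<noteq> {}\<close> cont] by metis
  obtain r where r: "r \<in> S" "\<And>x. x \<in> S \<Longrightarrow> x $ 1 \<le> r $ 1"
    using continuous_attains_sup[OF comp \<open>S \<noteq> {}\<close> cont] by metis
  have "l $ 1 < r $ 1"
  proof (rule ccontr)
    \<comment> \<open>Otherwise the second coordinate is injective on \<open>S\<close>, contrary to its values being repeated.\<close>
    assume "\<not> l $ 1 < r $ 1"
    then have vertical: "x $ 1 = l $ 1" if "x \<in> S" for x
      using l(2)[OF that] r(2)[OF that] by simp
    then have inj: "x = y" if "x \<in> S" "y \<in> S" "x $ 2 = y $ 2" for x y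
      using that by (simp add: vec_eq_iff forall_2)
    then obtain x y where xy: "x \<in> S" "y \<in> S" "x $ 2 < y $ 2"
      using ne by (metis linorder_less_linear)
    obtain s t where "s \<in> S" "t \<in> S" "s \<noteq> t" "s $ 2 = (x $ 2 + y $ 2) / 2" "t $ 2 = (x $ 2 + y $ 2) / 2"
      using sac_level_not_singleton[OF sac conn cont xy(1,2), of "2" "(x $ 2 + y $ 2) / 2"] xy(3)
      by auto
    then show False
      using inj by simp
  qed
  define c where "c = (l $ 1 + r $ 1) / 2"
  have c: "l $ 1 < c" "c < r $ 1"
    using \<open>l $ 1 < r $ 1\<close> by (auto simp: c_def)
  obtain p q where pq: "p \<in> S" "q \<in> S" "p \<noteq> q" "p $ 1 = c" "q $ 1 = c"
    using sac_level_not_singleton[OF sac conn cont l(1) r(1) c] by metis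
  define K where "K = S \<inter> {x. x $ 1 = c}"
  have "closed {x :: real ^ 2. x $ 1 = c}"
    by (intro closed_Collect_eq continuous_intros)
  then have "compact K"
    using comp by (simp add: K_def compact_Int_closed)
  moreover have "K \<noteq> {}"
    using pq by (auto simp: K_def)
  ultimately obtain s t where s: "s \<in> K" "\<And>x. x \<in> K \<Longrightarrow> s $ 2 \<le> x $ 2"
    and t: "t \<in> K" "\<And>x. x \<in> K \<Longrightarrow> x $ 2 \<le> t $ 2"
    using continuous_attains_inf[OF _ _ cont, of K 2] continuous_attains_sup[OF _ _ cont, of K 2]
    by blast
  have "s \<noteq> t"
  proof
    assume "s = t"
    then have "p $ 2 = q $ 2"
      using s(2)[of p] t(2)[of p] s(2)[of q] t(2)[of q] pq by (simp add: K_def)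
    then show False
      using pq by (simp add: vec_eq_iff forall_2)
  qed
  then have "distinct [l, r, s, t]" "{l, r, s, t} \<subseteq> S"
    using l(1) r(1) s(1) t(1) c by (auto simp: K_def)
  then obtain \<gamma> t1 t2 t3 t4 where \<gamma>: "path \<gamma>" "inj_on \<gamma> {0..1}" "\<gamma> ` {0..1} \<subseteq> S"
    and ts: "0 \<le> t1" "t1 < t2" "t2 < t3" "t3 < t4" "t4 \<le> 1"
    and visits: "\<gamma> t1 = l" "\<gamma> t2 = r" "\<gamma> t3 = s" "\<gamma> t4 = t"
    by (rule four_sacE[OF sac])
  show False
  proof (rule disjoint_crossing_pieces_impossible[OF _ _ _ _ \<gamma> ts visits])
    show "bounded S"
      using comp by (rule compact_imp_bounded)
    show "l $ 1 \<le> x $ 1 \<and> x $ 1 \<le> r $ 1" if "x \<in> S" for x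
      using l r that by simp
    show "s $ 1 = t $ 1"
      using s(1) t(1) by (simp add: K_def)
    show "s $ 2 \<le> x $ 2 \<and> x $ 2 \<le> t $ 2" if "x \<in> S" "x $ 1 = s $ 1" for x
      using s t that by (simp add: K_def)
  qed
qed

theorem proposition4:
  fixes X :: "'a topology"
  assumes "continuum X"
    and "planar_space X"
    and nondegenerate: "\<exists>x\<in>topspace X. \<exists>y\<in>topspace X. x \<noteq> y"
  shows "\<not> n_sac 4 X"
proof
  assume sac: "n_sac 4 X"
  obtain S :: "(real ^ 2) set" where S: "X homeomorphic_space top_of_set S"
    using assms(2) by (auto simp: planar_space_def)
  have "compact S"
    using homeomorphic_compact_space[OF S] assms(1)
    by (simp add: continuum_def flip: compactin_euclidean_iff add: compactin_subspace)
  moreover have "connected S"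
    using homeomorphic_connected_space[OF S] assms(1)
    by (simp add: continuum_def flip: connectedin_iff_connected add: connectedin_def)
  moreover have "\<exists>x\<in>S. \<exists>y\<in>S. x \<noteq> y"
  proof -
    obtain h where h: "homeomorphic_map X (top_of_set S) h"
      using S homeomorphic_space by blast
    have "h ` topspace X = S" "inj_on h (topspace X)"
      using homeomorphic_imp_surjective_map[OF h] homeomorphic_imp_injective_map[OF h] by simp_all
    then show ?thesis
      using nondegenerate by (metis imageI inj_onD)
  qed
  ultimately have "\<not> n_sac 4 (top_of_set S)"
    by (rule plane_continuum_not_4_sac)
  then show False
    using n_sac_homeomorphic_space[OF S sac] by simp
qed

end
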